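(* There is an absolute constant $\alpha>0$ such that the following holds. Let an additive buyer have valuations drawn from a distribution $V=\times_{j=1}^m V_j$ independent across items, and a private budget $b$ drawn, independently of the valuations, from a continuous monotone-hazard-rate distribution $B$. Then the better of pricing items separately and selling the grand bundle achieves a constant fraction of the optimal revenue: $$\max\{\mathrm{SRev}^B(V),\mathrm{BRev}^B(V)\}\ge \alpha\,\mathrm{Rev}^B(V).$$
   Context: A seller sells $m$ heterogeneous indivisible items (one copy each) to one buyer. The buyer's item values are $v\in\mathbb{R}_{\ge0}^m$, drawn from a discrete (finitely supported) distribution $V$ with support $T$; his value for a set $S$ is $\sum_{j\in S}v_j$; write $\|v\|_1=\sum_j|v_j|$. His budget $b\ge0$ is drawn from $B$, which has density $g$, cumulative distribution function $G$ and finite positive mean. The buyer knows $v$ and $b$; the seller knows only $V$ and $B$. $B$ is monotone-hazard-rate (MHR) if $g(b)/(1-G(b))$ is non-decreasing in $b$. $\mathrm{Rev}^B(V)$ is the optimal revenue with private budgets: the supremum of $\mathbb{E}_{v\sim V,\,b\sim B}[p(v,b)]$ over mechanisms $(\pi,p)$, assigning an allocation $\pi(t,b)\in[0,1]^m$ and a payment $p(t,b)\in\mathbb{R}$ with $p(t,b)\le b$ to each reported pair $(t,b)\in T\times\mathrm{supp}(B)$, such that for all $(t,b)$: $\pi(t,b)^\top t-p(t,b)\ge0$, and $\pi(t,b)^\top t-p(t,b)\ge\pi(t',b')^\top t-p(t',b')$ for every $(t',b')$ with $p(t',b')\le b$ (a report whose payment exceeds the true budget gives utility $-\infty$). $\mathrm{SRev}^B(V)$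 is the maximum expected revenue, over $v\sim V$ and $b\sim B$ independent, from posting fixed item prices $p_1,\dots,p_m\ge0$, where the buyer buys a set $S$ maximizing $\sum_{j\in S}(v_j-p_j)$ subject to $\sum_{j\in S}p_j\le b$ (ties broken in favor of the seller). $\mathrm{BRev}^B(V)=\sup_{p\ge0}\,p\cdot\Pr_{v\sim V,\,b\sim B}[\|v\|_1\ge p\text{ and }b\ge p]$. *)

theory Defs
  imports "HOL-Probability.Probability"
begin

text \<open>
  Items are the numbers below \<open>m\<close>; a valuation is a function \<open>nat \<Rightarrow> real\<close> of which only the
  values below \<open>m\<close> matter. Item values are explicit functions, not vectors over a finite index
  type, because \<open>m\<close> has to be quantified after the approximation constant.
\<close>

definition joint :: "(nat \<Rightarrow> real) pmf \<Rightarrow> real measure \<Rightarrow> ((nat \<Rightarrow> real) \<times> real) measure" where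
  "joint V B = measure_pmf V \<Otimes>\<^sub>M B"

definition supp :: "real measure \<Rightarrow> real set" where
  "supp B = {b. \<forall>U. open U \<and> b \<in> U \<longrightarrow> emeasure B U > 0}"

definition budget_distribution :: "real measure \<Rightarrow> (real \<Rightarrow> real) \<Rightarrow> bool" where
  "budget_distribution B g \<longleftrightarrow>
     g \<in> borel_measurable borel \<and> (\<forall>b. 0 \<le> g b) \<and> B = density lborel (\<lambda>b. ennreal (g b)) \<and>
     prob_space B \<and> (AE b in B. 0 \<le> b) \<and>
     integrable B (\<lambda>b. b) \<and> 0 < (\<integral>b. b \<partial>B)"

text \<open>The hazard rate is only defined where the distribution function is below one.\<close>

definition MHR :: "real measure \<Rightarrow> (real \<Rightarrow> real) \<Rightarrow> bool" where
  "MHR B g \<longleftrightarrow> mono_on {b. cdf B b < 1} (\<lambda>b. g b / (1 - cdf B b))"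

definition utility :: "nat \<Rightarrow> (nat \<Rightarrow> real) \<Rightarrow> (nat \<Rightarrow> real) \<Rightarrow> real \<Rightarrow> real" where
  "utility m t x c = (\<Sum>j<m. x j * t j) - c"

text \<open>
  Integrability of the payment is what makes the expected revenue a real number. Since payments
  are bounded by the budget, which has finite mean, it excludes only payment rules that are not
  measurable and those with expected revenue \<open>-\<infinity>\<close>.
\<close>

definition mechanism ::
  "nat \<Rightarrow> (nat \<Rightarrow> real) pmf \<Rightarrow> real measure \<Rightarrow>
   ((nat \<Rightarrow> real) \<Rightarrow> real \<Rightarrow> nat \<Rightarrow> real) \<Rightarrow> ((nat \<Rightarrow> real) \<Rightarrow> real \<Rightarrow> real) \<Rightarrow> bool" where
  "mechanism m V B \<pi> p \<longleftrightarrow>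
     (\<forall>t\<in>set_pmf V. \<forall>b\<in>supp B.
        (\<forall>j<m. \<pi> t b j \<in> {0..1}) \<and> p t b \<le> b \<and>
        0 \<le> utility m t (\<pi> t b) (p t b) \<and>
        (\<forall>t'\<in>set_pmf V. \<forall>b'\<in>supp B. p t' b' \<le> b \<longrightarrow>
           utility m t (\<pi> t' b') (p t' b') \<le> utility m t (\<pi> t b) (p t b))) \<and>
     set_integrable (joint V B) (set_pmf V \<times> supp B) (\<lambda>(t, b). p t b)"

text \<open>
  In the three suprema below the revenues are bounded by the mean of the budget, and the sets
  are nonempty, so the supremum over the reals is the intended one.
\<close>

definition Rev :: "nat \<Rightarrow> (nat \<Rightarrow> real) pmf \<Rightarrow> real measure \<Rightarrow> real" where
  "Rev m V B =
     (SUP (\<pi>, p)\<in>{(\<pi>, p). mechanism m V B \<pi> p}.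
        set_lebesgue_integral (joint V B) (set_pmf V \<times> supp B) (\<lambda>(t, b). p t b))"

definition demand :: "nat \<Rightarrow> (nat \<Rightarrow> real) \<Rightarrow> (nat \<Rightarrow> real) \<Rightarrow> real \<Rightarrow> nat set set" where
  "demand m q v b =
     {S. is_arg_max (\<lambda>S. \<Sum>j\<in>S. v j - q j) (\<lambda>S. S \<subseteq> {..<m} \<and> (\<Sum>j\<in>S. q j) \<le> b) S}"

text \<open>
  Taking the maximal payment over the demanded sets breaks ties in favor of the seller. The
  demand is nonempty for \<open>b \<ge> 0\<close>, since the empty set is affordable.
\<close>

definition SRev :: "nat \<Rightarrow> (nat \<Rightarrow> real) pmf \<Rightarrow> real measure \<Rightarrow> real" where
  "SRev m V B =
     (SUP q\<in>{q. \<forall>j<m. 0 \<le> q j}.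
        \<integral>(v, b). Max ((\<lambda>S. \<Sum>j\<in>S. q j) ` demand m q v b) \<partial>joint V B)"

definition BRev :: "nat \<Rightarrow> (nat \<Rightarrow> real) pmf \<Rightarrow> real measure \<Rightarrow> real" where
  "BRev m V B =
     (SUP c\<in>{0..}. c * \<P>((v, b) in joint V B. (\<Sum>j<m. \<bar>v j\<bar>) \<ge> c \<and> b \<ge> c))"

end

theory Submission
  imports Defs
begin

text \<open>
  Let \<open>\<beta>\<close> be half the mean budget. The hazard rate condition gives \<open>Pr[b \<ge> \<beta>] \<ge> 1/2\<close>, and scaling a
  mechanism down shows that revenue grows at most linearly in a public budget, so it is enough to
  treat the public budget \<open>\<beta>\<close>, provided that item pricing is credited only with the sales on the event
  that the total value stays below \<open>\<beta>\<close>: there every larger budget leads to the same purchase.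
  Let \<open>W\<close> bound this revenue and the revenue of bundle prices up to \<open>\<beta>\<close>.

  Types whose total value is at least \<open>\<beta>\<close> pay at most \<open>\<beta>\<close>, the revenue of the grand bundle at price
  \<open>\<beta>\<close>. For the others the budget does not bind. The payment of such a type is at most a
  single-parameter payment for its favorite item plus the values of its other items. With the other
  values fixed, the former is at most the revenue of the best price for the favorite item alone, and
  these revenues add up to at most \<open>6 * W\<close>. The values of the other items are split at \<open>6 * W\<close> into a
  tail, which is small because two large values rarely occur together, and a core, which concentrates
  around its mean and is thus recovered by selling the grand bundle.
\<close>

subsection \<open>Single-parameter mechanisms\<close>

text \<open>In the induction, \<open>K\<close> is the weight of the larger types already removed.\<close>

lemma sum_weighted_payment_le:
  fixes X :: "real set" and w a P :: "real \<Rightarrow> real"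
  assumes "finite X" and K: "0 \<le> K"
    and w: "\<And>x. x \<in> X \<Longrightarrow> 0 \<le> w x"
    and a: "\<And>x. x \<in> X \<Longrightarrow> 0 \<le> a x"
    and ir: "\<And>x. x \<in> X \<Longrightarrow> P x \<le> a x * x"
    and ic: "\<And>x y. x \<in> X \<Longrightarrow> y \<in> X \<Longrightarrow> a y * x - P y \<le> a x * x - P x"
    and tail: "\<And>y. y \<in> X \<Longrightarrow> y * (K + (\<Sum>x\<in>{x\<in>X. y \<le> x}. w x)) \<le> r"
    and "X \<noteq> {}"
  shows "(\<Sum>x\<in>X. w x * P x) + K * P (Max X) \<le> r * a (Max X)"
  using assms
proof (induction X arbitrary: K rule: finite_linorder_max_induct)
  case empty
  then show ?case by simp
next
  case (insert z X)
  have Max_z: "Max (insert z X) = z"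
    using insert.hyps by (intro Max_eqI) (auto intro: less_imp_le)
  have z_notin: "z \<notin> X" using insert.hyps by auto
  have "{x \<in> insert z X. z \<le> x} = {z}" using insert.hyps by force
  then have tail_z: "z * (K + w z) \<le> r" using insert.prems(6)[of z] by simp
  have wz: "0 \<le> w z" using insert.prems by simp
  show ?case
  proof (cases "X = {}")
    case True
    have "w z * P z + K * P z \<le> (K + w z) * (a z * z)"
      using mult_left_mono[OF insert.prems(4)[of z], of "K + w z"] insert.prems(1) wz
      by (simp add: algebra_simps)
    also have "\<dots> \<le> r * a z"
      using mult_right_mono[OF tail_z, of "a z"] insert.prems(3)[of z] by (simp add: algebra_simps)
    finally show ?thesis using True by simp
  next
    case False
    define y where "y = Max X"
    have y: "y \<in> X" using False insert.hyps by (simp add: y_def)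
    then have "y < z" using insert.hyps by auto
    have tails: "{x \<in> insert z X. u \<le> x} = insert z {x \<in> X. u \<le> x}" if "u \<in> X" for u
      using that insert.hyps by force
    have IH: "(\<Sum>x\<in>X. w x * P x) + (K + w z) * P y \<le> r * a y"
      unfolding y_def
    proof (rule insert.IH)
      fix u assume u: "u \<in> X"
      have "(\<Sum>x\<in>{x \<in> insert z X. u \<le> x}. w x) = w z + (\<Sum>x\<in>{x \<in> X. u \<le> x}. w x)"
        unfolding tails[OF u] using z_notin insert.hyps(1) by simp
      then show "u * (K + w z + (\<Sum>x\<in>{x \<in> X. u \<le> x}. w x)) \<le> r"
        using insert.prems(6)[of u] u by (simp add: add.assoc)
    qed (use insert.prems wz False in auto)
    \<comment> \<open>The increase of \<open>a\<close> from \<open>y\<close> to \<open>z\<close>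
      brings in at most its sale at price \<open>z\<close>. Types of weight \<open>K + w z\<close>
      pay it, and \<open>tail_z\<close> bounds the revenue of that price by
      \<open>r\<close>.\<close>
    have "P z \<le> P y + z * (a z - a y)"
      using insert.prems(5)[of z y] y by (simp add: algebra_simps)
    moreover have "0 \<le> (z - y) * (a z - a y)"
      using insert.prems(5)[of z y] insert.prems(5)[of y z] y by (simp add: algebra_simps)
    then have mono: "0 \<le> a z - a y" using \<open>y < z\<close> by (simp add: zero_le_mult_iff)
    ultimately have "(K + w z) * P z \<le> (K + w z) * P y + z * (K + w z) * (a z - a y)"
      using mult_left_mono[of "P z" _ "K + w z"] insert.prems(1) wz
      by (fastforce simp: algebra_simps)
    moreover have "z * (K + w z) * (a z - a y) \<le> r * (a z - a y)"
      using tail_z mono by (rule mult_right_mono)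
    ultimately show ?thesis
      using IH z_notin insert.hyps(1) unfolding Max_z by (simp add: algebra_simps)
  qed
qed

text \<open>This is \<open>sum_weighted_payment_le\<close> with \<open>K = 0\<close>. The set
  \<open>X\<close> will hold the types for which the budget does not bind, while prices are tested
  against the whole distribution, whose upper tails dominate those within \<open>X\<close>.\<close>

lemma expectation_single_parameter_payment_le:
  fixes p :: "real pmf"
  assumes fin: "finite (set_pmf p)" and r: "0 \<le> r"
    and a: "\<And>x. x \<in> set_pmf p \<Longrightarrow> x \<in> X \<Longrightarrow> a x \<in> {0..1::real}"
    and ir: "\<And>x. x \<in> set_pmf p \<Longrightarrow> x \<in> X \<Longrightarrow> P x \<le> a x * x"
    and ic: "\<And>x y. x \<in> set_pmf p \<Longrightarrow> x \<in> X \<Longrightarrow> y \<in> set_pmf p \<Longrightarrow> y \<in> X \<Longrightarrow>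
      a y * x - P y \<le> a x * x - P x"
    and nonneg: "\<And>y. y \<in> set_pmf p \<Longrightarrow> y \<in> X \<Longrightarrow> 0 \<le> y"
    and price: "\<And>y. y \<in> set_pmf p \<Longrightarrow> y \<in> X \<Longrightarrow>
      y * measure_pmf.prob p {y..} \<le> r"
  shows "measure_pmf.expectation p (\<lambda>x. P x * of_bool (x \<in> X)) \<le> r"
proof -
  define Y where "Y = set_pmf p \<inter> X"
  have Y: "finite Y" using fin by (simp add: Y_def)
  have E: "measure_pmf.expectation p (\<lambda>x. P x * of_bool (x \<in> X)) = (\<Sum>x\<in>Y. pmf p x * P x)"
    using Y by (subst integral_measure_pmf_real[where A = Y])
      (auto simp: Y_def mult.commute intro!: sum.cong)
  show ?thesis
  proof (cases "Y = {}")
    case True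
    then show ?thesis using E r by simp
  next
    case False
    have "(\<Sum>x\<in>Y. pmf p x * P x) + 0 * P (Max Y) \<le> r * a (Max Y)"
    proof (rule sum_weighted_payment_le[OF Y])
      fix y assume y: "y \<in> Y"
      have "(\<Sum>x\<in>{x\<in>Y. y \<le> x}. pmf p x) = measure_pmf.prob p {x\<in>Y. y \<le> x}"
        using Y by (simp add: measure_measure_pmf_finite)
      also have "\<dots> \<le> measure_pmf.prob p {y..}"
        by (intro measure_pmf.finite_measure_mono) auto
      finally show "y * (0 + (\<Sum>x\<in>{x\<in>Y. y \<le> x}. pmf p x)) \<le> r"
        using price[of y] nonneg[of y] y unfolding Y_def
        by (smt (verit) Int_iff mult_left_mono)
    qed (use False a ir ic in \<open>auto simp: Y_def\<close>)
    moreover have "Max Y \<in> Y" using Y False by simp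
    then have "r * a (Max Y) \<le> r" using a[of "Max Y"] r by (simp add: Y_def mult_left_le)
    ultimately show ?thesis using E by simp
  qed
qed

subsection \<open>Independent item values\<close>

locale item_values =
  fixes m :: nat and D :: "nat \<Rightarrow> real pmf"
  assumes finite_D: "\<And>j. j < m \<Longrightarrow> finite (set_pmf (D j))"
    and D_nonneg: "\<And>j x. j < m \<Longrightarrow> x \<in> set_pmf (D j) \<Longrightarrow> 0 \<le> x"
begin

abbreviation V :: "(nat \<Rightarrow> real) pmf" where "V \<equiv> Pi_pmf {..<m} 0 D"

abbreviation E :: "((nat \<Rightarrow> real) \<Rightarrow> real) \<Rightarrow> real" where "E \<equiv> measure_pmf.expectation V"

abbreviation total :: "(nat \<Rightarrow> real) \<Rightarrow> real" where "total v \<equiv> \<Sum>j<m. v j"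

lemma finite_V: "finite (set_pmf V)"
  by (rule finite_subset[OF set_Pi_pmf_subset']) (use finite_D in auto)

lemma integrable_V [simp, intro]: "integrable (measure_pmf V) (f :: _ \<Rightarrow> real)"
  using finite_V by (rule integrable_measure_pmf_finite)

lemma V_component: "v \<in> set_pmf V \<Longrightarrow> j < m \<Longrightarrow> v j \<in> set_pmf (D j)"
  by (auto simp: set_Pi_pmf PiE_dflt_def)

lemma V_nonneg: "v \<in> set_pmf V \<Longrightarrow> j < m \<Longrightarrow> 0 \<le> v j"
  using V_component D_nonneg by blast

lemma V_fun_upd: "v \<in> set_pmf V \<Longrightarrow> j < m \<Longrightarrow> x \<in> set_pmf (D j) \<Longrightarrow> v(j := x) \<in> set_pmf V"
  by (auto simp: set_Pi_pmf PiE_dflt_def)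

lemma component_le_total: "v \<in> set_pmf V \<Longrightarrow> j < m \<Longrightarrow> v j \<le> total v"
  using V_nonneg by (intro member_le_sum) auto

lemma E_mono: "(\<And>v. v \<in> set_pmf V \<Longrightarrow> f v \<le> h v) \<Longrightarrow> E f \<le> E h"
  by (intro integral_mono_AE) (auto simp: AE_measure_pmf_iff)

lemma E_cong: "(\<And>v. v \<in> set_pmf V \<Longrightarrow> f v = h v) \<Longrightarrow> E f = E h"
  by (intro integral_cong_AE) (auto simp: AE_measure_pmf_iff)

lemma E_of_bool: "E (\<lambda>v. of_bool (Q v)) = measure_pmf.prob V {v. Q v}"
proof -
  have "(\<lambda>v. of_bool (Q v) :: real) = indicator {v. Q v}" by (auto simp: indicator_def)
  then show ?thesis by simp
qed

lemma E_component: "j < m \<Longrightarrow> E (\<lambda>v. h (v j)) = measure_pmf.expectation (D j) h"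
  using integral_map_pmf[of "\<lambda>v. v j" V h] by (simp add: Pi_pmf_component)

text \<open>Redrawing coordinate \<open>j\<close> leaves a product distribution unchanged: the
  second draw overwrites the first, which then integrates out. This allows a single item to be
  treated with the other values fixed.\<close>

lemma E_resample:
  assumes j: "j < m"
  shows "E h = E (\<lambda>v. measure_pmf.expectation (D j) (\<lambda>x. h (v(j := x))))"
proof -
  have A: "{..<m} = insert j ({..<m} - {j})" using j by auto
  define P where "P = Pi_pmf ({..<m} - {j}) 0 D"
  have V: "V = bind_pmf (D j) (\<lambda>y. bind_pmf P (\<lambda>f. return_pmf (f(j := y))))"
    unfolding P_def by (subst A, subst Pi_pmf_insert') auto
  have "bind_pmf V (\<lambda>v. map_pmf (\<lambda>x. v(j := x)) (D j))
      = bind_pmf P (\<lambda>f. bind_pmf (D j) (\<lambda>x. return_pmf (f(j := x))))"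
    unfolding V by (simp add: bind_assoc_pmf bind_return_pmf map_pmf_def)
  also have "\<dots> = V"
    unfolding V by (rule bind_commute_pmf)
  finally have "E h = measure_pmf.expectation (bind_pmf V (\<lambda>v. map_pmf (\<lambda>x. v(j := x)) (D j))) h"
    by simp
  also have "\<dots> = (\<Sum>v\<in>set_pmf V. pmf V v *\<^sub>R
      measure_pmf.expectation (map_pmf (\<lambda>x. v(j := x)) (D j)) h)"
    using finite_D[OF j] by (intro pmf_expectation_bind finite_V) auto
  also have "\<dots> = E (\<lambda>v. measure_pmf.expectation (D j) (\<lambda>x. h (v(j := x))))"
    by (subst integral_measure_pmf[OF finite_V]) auto
  finally show ?thesis .
qed

text \<open>Resampling coordinate \<open>j\<close>, which \<open>h\<close> ignores, averages the
  factor \<open>f\<close> alone.\<close>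

lemma E_mult_independent:
  assumes j: "j < m" and h: "\<And>v x. h (v(j := x)) = h v"
  shows "E (\<lambda>v. f (v j) * h v) = E (\<lambda>v. f (v j)) * E h"
proof -
  have "E (\<lambda>v. f (v j) * h v) = E (\<lambda>v. measure_pmf.expectation (D j) f * h v)"
    by (subst E_resample[OF j]) (simp add: h)
  then show ?thesis by (simp add: E_component[OF j])
qed

text \<open>By independence the variances add up, and each is at most the second moment, hence at
  most \<open>R\<close> times the mean.\<close>

lemma variance_sum_le:
  assumes c: "\<And>j v. j < m \<Longrightarrow> v \<in> set_pmf V \<Longrightarrow> 0 \<le> c j (v j) \<and> c j (v j) \<le> R"
  defines "C \<equiv> \<lambda>v. \<Sum>j<m. c j (v j)"
  shows "E (\<lambda>v. (C v - E C)\<^sup>2) \<le> R * E C"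
proof -
  define d where "d j x = c j x - E (\<lambda>v. c j (v j))" for j x
  have EC: "E C = (\<Sum>j<m. E (\<lambda>v. c j (v j)))" unfolding C_def by simp
  have Ed: "E (\<lambda>v. d j (v j)) = 0" for j unfolding d_def by simp
  have "E (\<lambda>v. (C v - E C)\<^sup>2) = E (\<lambda>v. \<Sum>i<m. \<Sum>j<m. d i (v i) * d j (v j))"
    unfolding EC by (simp add: C_def d_def power2_eq_square sum_product flip: sum_subtractf)
  also have "\<dots> = (\<Sum>i<m. \<Sum>j<m. E (\<lambda>v. d i (v i) * d j (v j)))"
    by simp
  also have "\<dots> = (\<Sum>i<m. \<Sum>j<m. if i = j then E (\<lambda>v. (d i (v i))\<^sup>2) else 0)"
  proof (intro sum.cong refl)
    fix i j assume ij: "i \<in> {..<m}" "j \<in> {..<m}"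
    show "E (\<lambda>v. d i (v i) * d j (v j)) = (if i = j then E (\<lambda>v. (d i (v i))\<^sup>2) else 0)"
    proof (cases "i = j")
      case False
      then show ?thesis
        using E_mult_independent[of i "\<lambda>v. d j (v j)" "d i"] ij by (simp add: Ed)
    qed (simp add: power2_eq_square)
  qed
  also have "\<dots> = (\<Sum>i<m. E (\<lambda>v. (d i (v i))\<^sup>2))"
    by simp
  also have "\<dots> \<le> (\<Sum>i<m. R * E (\<lambda>v. c i (v i)))"
  proof (rule sum_mono)
    fix i assume i: "i \<in> {..<m}"
    have "E (\<lambda>v. (d i (v i))\<^sup>2) = E (\<lambda>v. (c i (v i))\<^sup>2) - (E (\<lambda>v. c i (v i)))\<^sup>2"
      unfolding d_def by (rule measure_pmf.variance_eq) auto
    also have "\<dots> \<le> E (\<lambda>v. R * c i (v i))"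
    proof -
      have "E (\<lambda>v. (c i (v i))\<^sup>2) \<le> E (\<lambda>v. R * c i (v i))"
        using c i by (intro E_mono) (auto simp: power2_eq_square intro!: mult_right_mono)
      then show ?thesis by (smt (verit) zero_le_power2)
    qed
    finally show "E (\<lambda>v. (d i (v i))\<^sup>2) \<le> R * E (\<lambda>v. c i (v i))" by simp
  qed
  finally show ?thesis unfolding EC by (simp add: sum_distrib_left)
qed

end

subsection \<open>Public budgets\<close>

text \<open>Where the total value is below \<open>\<beta>\<close>, all items priced at or below
  their values are affordable together, so \<open>item_pricing\<close> can express the revenue
  without the demand.\<close>

locale public_budget = item_values +
  fixes \<beta> W :: real
  assumes \<beta>_nonneg: "0 \<le> \<beta>" and W_nonneg: "0 \<le> W"
    and item_pricing: "\<And>q. (\<And>j. j < m \<Longrightarrow> 0 \<le> q j) \<Longrightarrow>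
      E (\<lambda>v. (\<Sum>j<m. q j * of_bool (q j \<le> v j)) * of_bool (total v < \<beta>)) \<le> W"
    and bundle_pricing: "\<And>c. 0 \<le> c \<Longrightarrow> c \<le> \<beta> \<Longrightarrow> c * measure_pmf.prob V {v. c \<le> total v} \<le> W"
begin

text \<open>
  Each item is sold independently of the event that the other items together stay below the
  budget, which has probability at least one half. When the grand total exceeds the budget, the
  prices paid on these events still add up to at most twice the budget.
\<close>

lemma sum_price_prob_le:
  assumes likely: "1 / 2 \<le> measure_pmf.prob V {v. total v < \<beta>}"
    and q: "\<And>j. j < m \<Longrightarrow> 0 \<le> q j \<and> q j \<le> \<beta>"
  shows "(\<Sum>j<m. q j * measure_pmf.prob (D j) {q j..}) \<le> 6 * W"
proof -
  define rest where "rest j v = (\<Sum>i\<in>{..<m} - {j}. v i)" for j and v :: "nat \<Rightarrow> real"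
  define sold where "sold j v = q j * of_bool (q j \<le> v j)" for j and v :: "nat \<Rightarrow> real"
  have rest: "total v = v j + rest j v" if "j < m" for j v
    unfolding rest_def using that by (intro sum.remove) auto
  have rest_upd: "rest j (v(j := x)) = rest j v" for j v x
    unfolding rest_def by (intro sum.cong) auto
  have E_sold: "E (sold j) = q j * measure_pmf.prob (D j) {q j..}" if "j < m" for j
  proof -
    have "(\<lambda>x. of_bool (q j \<le> x) :: real) = indicator {q j..}" by (auto simp: indicator_def)
    then show ?thesis
      unfolding sold_def using E_component[OF that, of "\<lambda>x. of_bool (q j \<le> x)"] by simp
  qed
  have rest_likely: "1 / 2 \<le> E (\<lambda>v. of_bool (rest j v < \<beta>))" if "j < m" for j
  proof -
    have "1 / 2 \<le> E (\<lambda>v. of_bool (total v < \<beta>))" using likely by (simp add: E_of_bool)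
    also have "\<dots> \<le> E (\<lambda>v. of_bool (rest j v < \<beta>))"
      using rest[OF that] V_nonneg[OF _ that] by (intro E_mono) (force split: split_of_bool)
    finally show ?thesis .
  qed
  have pointwise: "(\<Sum>j<m. sold j v * of_bool (rest j v < \<beta>)) \<le>
      (\<Sum>j<m. sold j v) * of_bool (total v < \<beta>) + 2 * (\<beta> * of_bool (\<beta> \<le> total v))"
    if v: "v \<in> set_pmf V" for v
  proof -
    have sold_nonneg: "0 \<le> sold j v" if "j < m" for j
      using q[OF that] by (simp add: sold_def)
    have sold_le: "sold j v \<le> v j" if "j < m" for j
      using q[OF that] V_nonneg[OF v that] by (simp add: sold_def)
    show ?thesis
    proof (cases "total v < \<beta>")
      case True
      have "(\<Sum>j<m. sold j v * of_bool (rest j v < \<beta>)) \<le> (\<Sum>j<m. sold j v)"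
        using sold_nonneg by (intro sum_mono) auto
      then show ?thesis using True by simp
    next
      case False
      show ?thesis
      proof (cases "\<exists>k<m. rest k v < \<beta>")
        case True
        then obtain k where k: "k < m" "rest k v < \<beta>" by blast
        have "(\<Sum>j<m. sold j v * of_bool (rest j v < \<beta>)) \<le> (\<Sum>j<m. sold j v)"
          using sold_nonneg by (intro sum_mono) auto
        also have "\<dots> = sold k v + (\<Sum>j\<in>{..<m} - {k}. sold j v)"
          using k by (intro sum.remove) auto
        \<comment> \<open>Item \<open>k\<close> costs at most \<open>\<beta>\<close>; the other
          items sold cost at most their values, which sum to
          \<open>rest k v < \<beta>\<close>.\<close>
        also have "\<dots> \<le> \<beta> + rest k v"
          unfolding rest_def
          using q[OF k(1)] \<beta>_nonneg sold_le by (intro add_mono sum_mono) (auto simp: sold_def)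
        finally show ?thesis using k False by simp
      next
        case none: False
        then have "(\<Sum>j<m. sold j v * of_bool (rest j v < \<beta>)) = 0"
          by (intro sum.neutral) auto
        then show ?thesis using False \<beta>_nonneg by simp
      qed
    qed
  qed
  have "(\<Sum>j<m. q j * measure_pmf.prob (D j) {q j..}) / 2 = (\<Sum>j<m. E (sold j) * (1 / 2))"
    by (simp add: E_sold sum_divide_distrib)
  also have "\<dots> \<le> (\<Sum>j<m. E (sold j) * E (\<lambda>v. of_bool (rest j v < \<beta>)))"
    using rest_likely q by (intro sum_mono mult_left_mono) (auto simp: E_sold)
  also have "\<dots> = (\<Sum>j<m. E (\<lambda>v. sold j v * of_bool (rest j v < \<beta>)))"
  proof (intro sum.cong refl)
    fix j assume "j \<in> {..<m}"
    then show "E (sold j) * E (\<lambda>v. of_bool (rest j v < \<beta>)) =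
        E (\<lambda>v. sold j v * of_bool (rest j v < \<beta>))"
      using E_mult_independent[of j "\<lambda>v. of_bool (rest j v < \<beta>)" "\<lambda>x. q j * of_bool (q j \<le> x)"]
      by (simp add: sold_def [abs_def] rest_upd)
  qed
  also have "\<dots> = E (\<lambda>v. \<Sum>j<m. sold j v * of_bool (rest j v < \<beta>))"
    by (rule Bochner_Integration.integral_sum[symmetric]) simp
  also have "\<dots> \<le> E (\<lambda>v. (\<Sum>j<m. sold j v) * of_bool (total v < \<beta>)
      + 2 * (\<beta> * of_bool (\<beta> \<le> total v)))"
    by (intro E_mono pointwise)
  also have "\<dots> = E (\<lambda>v. (\<Sum>j<m. sold j v) * of_bool (total v < \<beta>))
      + 2 * (\<beta> * measure_pmf.prob V {v. \<beta> \<le> total v})"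
    by (simp add: E_of_bool)
  \<comment> \<open>The item prices give \<open>W\<close> and the bundle at price
    \<open>\<beta>\<close> gives \<open>2 * W\<close>; undoing the factor one half on the left
    yields \<open>6 * W\<close>.\<close>
  also have "\<dots> \<le> W + 2 * W"
    unfolding sold_def using item_pricing[of q] q bundle_pricing[of \<beta>] \<beta>_nonneg
    by (intro add_mono) auto
  finally show ?thesis by simp
qed

text \<open>A value \<open>x\<close> counts only when another value is at least \<open>x\<close>. By
  the union bound, \<open>x\<close> times the probability of this is at most the total revenue of
  the uniform price \<open>x\<close>, hence at most \<open>6 * W\<close>. So item \<open>j\<close>
  adds at most \<open>6 * W\<close> times the probability of \<open>v j \<ge> 6 * W\<close>, and the
  uniform price \<open>6 * W\<close> bounds the sum of these.\<close>

lemma E_tail_le: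
  assumes likely: "1 / 2 \<le> measure_pmf.prob V {v. total v < \<beta>}" and W: "6 * W \<le> \<beta>"
  shows "E (\<lambda>v. \<Sum>j<m. v j * of_bool (6 * W < v j) *
      of_bool ((\<exists>i<m. i \<noteq> j \<and> v j \<le> v i) \<and> total v < \<beta>)) \<le> 6 * W"
proof -
  let ?R = "6 * W"
  let ?h = "\<lambda>j v. v j * of_bool (?R < v j) * of_bool ((\<exists>i<m. i \<noteq> j \<and> v j \<le> v i) \<and> total v < \<beta>)"
  have "E (?h j) \<le> ?R * measure_pmf.prob (D j) {?R..}" if j: "j < m" for j
  proof -
    have fin: "finite (set_pmf (D j))" using finite_D[OF j] .
    have int: "integrable (measure_pmf (D j)) f" for f :: "real \<Rightarrow> real"
      using fin by (rule integrable_measure_pmf_finite)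
    have "E (?h j) = E (\<lambda>v. measure_pmf.expectation (D j) (\<lambda>x. ?h j (v(j := x))))"
      by (rule E_resample[OF j])
    also have "\<dots> = measure_pmf.expectation (D j) (\<lambda>x. E (\<lambda>v. ?h j (v(j := x))))"
      by (simp only: integral_measure_pmf_real[OF fin] Bochner_Integration.integral_sum integrable_V
          integral_mult_left_zero)
    also have "\<dots> \<le> measure_pmf.expectation (D j) (\<lambda>x. ?R * indicator {?R..} x)"
    proof (intro integral_mono_AE int, unfold AE_measure_pmf_iff, intro ballI)
      fix x assume x: "x \<in> set_pmf (D j)"
      have x0: "0 \<le> x" using D_nonneg[OF j x] .
      show "E (\<lambda>v. ?h j (v(j := x))) \<le> ?R * indicator {?R..} x"
      proof (cases "?R < x \<and> x < \<beta>")
        case True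
        have "E (\<lambda>v. ?h j (v(j := x))) \<le> E (\<lambda>v. \<Sum>i<m. x * of_bool (x \<le> v i))"
        proof (intro E_mono)
          fix v
          show "?h j (v(j := x)) \<le> (\<Sum>i<m. x * of_bool (x \<le> v i))"
          proof (cases "\<exists>i<m. i \<noteq> j \<and> x \<le> v i")
            case True
            then obtain i where i: "i < m" "i \<noteq> j" "x \<le> v i" by blast
            have "?h j (v(j := x)) \<le> x" using x0 by simp
            also have "x \<le> x * of_bool (x \<le> v i)" using i by simp
            also have "\<dots> \<le> (\<Sum>i<m. x * of_bool (x \<le> v i))"
              using i x0 by (intro member_le_sum) auto
            finally show ?thesis .
          next
            case False
            then have "\<not> (\<exists>i<m. i \<noteq> j \<and> (v(j := x)) j \<le> (v(j := x)) i)" by auto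
            then have "?h j (v(j := x)) = 0" by (simp del: fun_upd_apply)
            moreover have "0 \<le> (\<Sum>i<m. x * of_bool (x \<le> v i))" using x0 by (intro sum_nonneg) auto
            ultimately show ?thesis by linarith
          qed
        qed
        also have "\<dots> = (\<Sum>i<m. x * E (\<lambda>v. of_bool (x \<le> v i)))"
          by (subst Bochner_Integration.integral_sum) auto
        also have "\<dots> = (\<Sum>i<m. x * measure_pmf.prob (D i) {x..})"
        proof (intro sum.cong refl)
          fix i assume "i \<in> {..<m}"
          moreover have "(\<lambda>y. of_bool (x \<le> y) :: real) = indicator {x..}"
            by (auto simp: indicator_def)
          ultimately show "x * E (\<lambda>v. of_bool (x \<le> v i)) = x * measure_pmf.prob (D i) {x..}"
            using E_component[of i "\<lambda>y. of_bool (x \<le> y)"] by simp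
        qed
        also have "\<dots> \<le> ?R"
          using True x0 by (intro sum_price_prob_le likely) auto
        finally show ?thesis using True by simp
      next
        case False
        \<comment> \<open>Here \<open>x\<close> belongs to the core or, being at least
          \<open>\<beta>\<close>, lifts the total to \<open>\<beta>\<close> or more; the term
          vanishes in both cases.\<close>
        have "E (\<lambda>v. ?h j (v(j := x))) = E (\<lambda>v. 0)"
        proof (intro E_cong)
          fix v assume v: "v \<in> set_pmf V"
          show "?h j (v(j := x)) = 0"
            using False component_le_total[OF V_fun_upd[OF v j x] j] by auto
        qed
        also have "\<dots> \<le> ?R * indicator {?R..} x" using W_nonneg by simp
        finally show ?thesis .
      qed
    qed
    also have "\<dots> = ?R * measure_pmf.prob (D j) {?R..}" by simp
    finally show ?thesis .
  qed
  then have "(\<Sum>j<m. E (?h j)) \<le> (\<Sum>j<m. ?R * measure_pmf.prob (D j) {?R..})"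
    by (intro sum_mono) auto
  also have "\<dots> \<le> ?R"
    using W W_nonneg by (intro sum_price_prob_le likely) auto
  finally show ?thesis
    by (subst Bochner_Integration.integral_sum) (rule integrable_V)
qed

text \<open>
  Chebyshev's inequality: the core is a sum of independent variables bounded by \<open>6 * W\<close>, so a mean
  above \<open>48 * W\<close> would make the grand bundle sell at half that mean with probability one half.
\<close>

lemma E_core_le:
  assumes W: "6 * W < \<beta>"
  shows "E (\<lambda>v. \<Sum>j<m. v j * of_bool (v j \<le> 6 * W)) \<le> 48 * W"
proof (rule ccontr)
  define c :: "nat \<Rightarrow> real \<Rightarrow> real" where "c j x = x * of_bool (x \<le> 6 * W)" for j x
  define C where "C v = (\<Sum>j<m. c j (v j))" for v
  define \<mu> where "\<mu> = E C"
  assume "\<not> ?thesis"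
  then have \<mu>: "48 * W < \<mu>" by (simp add: \<mu>_def C_def [abs_def] c_def)
  then have \<mu>_pos: "0 < \<mu>" using W_nonneg by linarith
  have "measure_pmf.prob V {v \<in> space (measure_pmf V). \<bar>C v - \<mu>\<bar> \<ge> \<mu> / 2}
      \<le> E (\<lambda>v. (C v - \<mu>)\<^sup>2) / (\<mu> / 2)\<^sup>2"
    unfolding \<mu>_def
    by (rule measure_pmf.Chebyshev_inequality) (use \<mu>_pos in \<open>auto simp: \<mu>_def\<close>)
  also have "\<dots> \<le> 6 * W * \<mu> / (\<mu> / 2)\<^sup>2"
  proof (rule divide_right_mono)
    show "E (\<lambda>v. (C v - \<mu>)\<^sup>2) \<le> 6 * W * \<mu>"
      unfolding \<mu>_def C_def
      by (rule variance_sum_le) (use V_nonneg W_nonneg in \<open>auto simp: c_def\<close>)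
  qed simp
  \<comment> \<open>The quotient is \<open>24 * W / \<mu>\<close>, whence the threshold
    \<open>48 * W\<close> for \<open>\<mu>\<close>.\<close>
  also have "\<dots> \<le> 1 / 2"
    using \<mu> \<mu>_pos by (simp add: power2_eq_square field_simps)
  finally have "measure_pmf.prob V {v. \<bar>C v - \<mu>\<bar> \<ge> \<mu> / 2} \<le> 1 / 2" by simp
  then have half: "1 / 2 \<le> measure_pmf.prob V {v. \<bar>C v - \<mu>\<bar> < \<mu> / 2}"
    using measure_pmf.prob_neg[of V "\<lambda>v. \<bar>C v - \<mu>\<bar> \<ge> \<mu> / 2"] by (simp add: not_le)
  \<comment> \<open>The cap at \<open>\<beta>\<close> makes \<open>b\<close> a price covered by
    \<open>bundle_pricing\<close>. Selling with probability one half would earn too much either way: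
    \<open>\<mu> / 4 > 12 * W\<close> or \<open>\<beta> / 2 > 3 * W\<close>.\<close>
  define b where "b = min (\<mu> / 2) \<beta>"
  have b: "0 < b" using \<mu>_pos W W_nonneg by (simp add: b_def)
  note half
  also have "measure_pmf.prob V {v. \<bar>C v - \<mu>\<bar> < \<mu> / 2} = E (\<lambda>v. of_bool (\<bar>C v - \<mu>\<bar> < \<mu> / 2))"
    by (simp add: E_of_bool)
  also have "\<dots> \<le> E (\<lambda>v. of_bool (b \<le> total v))"
  proof (intro E_mono)
    fix v assume v: "v \<in> set_pmf V"
    have "C v \<le> total v"
      unfolding C_def c_def using V_nonneg[OF v] by (intro sum_mono) auto
    moreover have "\<mu> / 2 \<le> C v" if "\<bar>C v - \<mu>\<bar> < \<mu> / 2"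
      using that by (auto simp: abs_if field_simps split: if_splits)
    ultimately show "of_bool (\<bar>C v - \<mu>\<bar> < \<mu> / 2) \<le> (of_bool (b \<le> total v) :: real)"
      by (force simp: b_def min_def split: split_of_bool)
  qed
  also have "\<dots> = measure_pmf.prob V {v. b \<le> total v}" by (simp add: E_of_bool)
  finally have "b * (1 / 2) \<le> b * measure_pmf.prob V {v. b \<le> total v}"
    using b by (intro mult_left_mono) auto
  also have "\<dots> \<le> W" using b by (intro bundle_pricing) (auto simp: b_def)
  finally show False using \<mu> W W_nonneg by (auto simp: b_def min_def split: if_splits)
qed

text \<open>One public budget bounds all payments, so every report is affordable and
  \<open>ic\<close> carries no affordability condition.\<close>

context
  fixes \<pi> :: "(nat \<Rightarrow> real) \<Rightarrow> nat \<Rightarrow> real" and p :: "(nat \<Rightarrow> real) \<Rightarrow> real"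
  assumes alloc: "\<And>t j. t \<in> set_pmf V \<Longrightarrow> j < m \<Longrightarrow> \<pi> t j \<in> {0..1}"
    and budget: "\<And>t. t \<in> set_pmf V \<Longrightarrow> p t \<le> \<beta>"
    and ir: "\<And>t. t \<in> set_pmf V \<Longrightarrow> 0 \<le> utility m t (\<pi> t) (p t)"
    and ic: "\<And>t t'. t \<in> set_pmf V \<Longrightarrow> t' \<in> set_pmf V \<Longrightarrow>
      utility m t (\<pi> t') (p t') \<le> utility m t (\<pi> t) (p t)"
begin

text \<open>
  With the other values fixed, charging \<open>\<pi> v j * v j\<close> minus the buyer's utility for item \<open>j\<close> is an
  incentive compatible mechanism for the single value \<open>v j\<close>.
\<close>

lemma E_single_item_payment_le:
  assumes j: "j < m" and r: "0 \<le> r"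
    and price: "\<And>y. y \<in> set_pmf (D j) \<Longrightarrow> y < \<beta> \<Longrightarrow> y * measure_pmf.prob (D j) {y..} \<le> r"
    and Q: "\<And>v. v \<in> set_pmf V \<Longrightarrow> Q v \<Longrightarrow> total v < \<beta>"
  shows "E (\<lambda>v. (\<pi> v j * v j - utility m v (\<pi> v) (p v)) * of_bool (Q v)) \<le> r"
proof -
  let ?P = "\<lambda>v. \<pi> v j * v j - utility m v (\<pi> v) (p v)"
  have "E (\<lambda>v. ?P v * of_bool (Q v)) =
      E (\<lambda>v. measure_pmf.expectation (D j) (\<lambda>x. ?P (v(j := x)) * of_bool (Q (v(j := x)))))"
    by (rule E_resample[OF j])
  also have "\<dots> \<le> E (\<lambda>v. r)"
  proof (intro E_mono)
    fix v assume v: "v \<in> set_pmf V"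
    note upd = V_fun_upd[OF v j]
    have "measure_pmf.expectation (D j) (\<lambda>x. ?P (v(j := x)) * of_bool (x \<in> {x. Q (v(j := x))})) \<le> r"
    proof (rule expectation_single_parameter_payment_le[where a = "\<lambda>x. \<pi> (v(j := x)) j"])
      fix x y assume x: "x \<in> set_pmf (D j)" and y: "y \<in> set_pmf (D j)"
      \<comment> \<open>The other items contribute \<open>s z\<close>, which depends on the report
        alone. The payment for item \<open>j\<close> at report \<open>z\<close> is thus
        \<open>p (v(j := z)) - s z\<close>, and incentive compatibility passes to it.\<close>
      define s where "s z = (\<Sum>i\<in>{..<m} - {j}. \<pi> (v(j := z)) i * v i)" for z
      have u: "utility m (v(j := x)) (\<pi> (v(j := z))) c = \<pi> (v(j := z)) j * x + s z - c" for x z c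
      proof -
        have "(\<Sum>i<m. \<pi> (v(j := z)) i * (v(j := x)) i)
            = \<pi> (v(j := z)) j * x + (\<Sum>i\<in>{..<m} - {j}. \<pi> (v(j := z)) i * (v(j := x)) i)"
          using j by (subst sum.remove[of _ j]) auto
        also have "(\<Sum>i\<in>{..<m} - {j}. \<pi> (v(j := z)) i * (v(j := x)) i) = s z"
          unfolding s_def by (intro sum.cong) auto
        finally show ?thesis by (simp only: utility_def)
      qed
      show "\<pi> (v(j := y)) j * x - ?P (v(j := y)) \<le> \<pi> (v(j := x)) j * x - ?P (v(j := x))"
        using ic[OF upd[OF x] upd[OF y]] by (simp add: u)
    next
      fix y assume "y \<in> set_pmf (D j)" "y \<in> {x. Q (v(j := x))}"
      then show "y * measure_pmf.prob (D j) {y..} \<le> r"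
        using Q[OF upd[of y]] component_le_total[OF upd[of y] j] by (intro price) auto
    next
      fix x assume x: "x \<in> set_pmf (D j)"
      show "\<pi> (v(j := x)) j \<in> {0..1}" using alloc[OF upd[OF x] j] .
      show "?P (v(j := x)) \<le> \<pi> (v(j := x)) j * x" using ir[OF upd[OF x]] by simp
    qed (use finite_D D_nonneg j r in auto)
    then show "measure_pmf.expectation (D j) (\<lambda>x. ?P (v(j := x)) * of_bool (Q (v(j := x)))) \<le> r"
      by simp
  qed
  finally show ?thesis by simp
qed

text \<open>With \<open>q j\<close> the best price for item \<open>j\<close> among its values below
  \<open>\<beta>\<close>, the payments for item \<open>j\<close> earn no more than this price, and
  \<open>sum_price_prob_le\<close> bounds the sum of these revenues. The event \<open>Q j\<close>
  will be that \<open>j\<close> is the favorite.\<close>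

lemma E_favorite_payment_le:
  assumes likely: "1 / 2 \<le> measure_pmf.prob V {v. total v < \<beta>}"
    and Q: "\<And>j v. v \<in> set_pmf V \<Longrightarrow> Q j v \<Longrightarrow> total v < \<beta>"
  shows "E (\<lambda>v. \<Sum>j<m. (\<pi> v j * v j - utility m v (\<pi> v) (p v)) * of_bool (Q j v)) \<le> 6 * W"
proof -
  have "\<exists>x. 0 \<le> x \<and> x \<le> \<beta> \<and>
      (\<forall>y\<in>set_pmf (D j). y < \<beta> \<longrightarrow>
        y * measure_pmf.prob (D j) {y..} \<le> x * measure_pmf.prob (D j) {x..})"
    if j: "j < m" for j
  proof -
    \<comment> \<open>The price 0 serves an item that has no value below
      \<open>\<beta>\<close>.\<close>
    let ?X = "insert 0 (set_pmf (D j) \<inter> {..<\<beta>})"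
    let ?f = "\<lambda>x. x * measure_pmf.prob (D j) {x..}"
    have fin: "finite ?X" using finite_D[OF j] by simp
    then have "Max (?f ` ?X) \<in> ?f ` ?X" by (intro Max_in) auto
    then obtain x where x: "x \<in> ?X" "Max (?f ` ?X) = ?f x" by blast
    have "?f y \<le> ?f x" if "y \<in> ?X" for y
      using that fin unfolding x(2)[symmetric] by (intro Max_ge) auto
    then show ?thesis using x(1) D_nonneg[OF j] \<beta>_nonneg by (intro exI[of _ x]) auto
  qed
  then obtain q where q: "\<And>j. j < m \<Longrightarrow> 0 \<le> q j \<and> q j \<le> \<beta>"
    "\<And>j y. j < m \<Longrightarrow> y \<in> set_pmf (D j) \<Longrightarrow> y < \<beta> \<Longrightarrow>
        y * measure_pmf.prob (D j) {y..} \<le> q j * measure_pmf.prob (D j) {q j..}"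
    by metis
  have "E (\<lambda>v. \<Sum>j<m. (\<pi> v j * v j - utility m v (\<pi> v) (p v)) * of_bool (Q j v))
      = (\<Sum>j<m. E (\<lambda>v. (\<pi> v j * v j - utility m v (\<pi> v) (p v)) * of_bool (Q j v)))"
    by (rule Bochner_Integration.integral_sum) simp
  also have "\<dots> \<le> (\<Sum>j<m. q j * measure_pmf.prob (D j) {q j..})"
    using q Q by (intro sum_mono E_single_item_payment_le) auto
  also have "\<dots> \<le> 6 * W" using likely q(1) by (rule sum_price_prob_le)
  finally show ?thesis .
qed

text \<open>The constant is \<open>1 + 6 + 6 + 48\<close>: the bundle at price
  \<open>\<beta>\<close>, the favorite items, the tail and the core.\<close>

lemma E_payment_le: "E p \<le> 61 * W"
proof (cases "\<beta> \<le> 6 * W \<or> measure_pmf.prob V {v. total v < \<beta>} < 1 / 2")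
  case True
  have "\<beta> \<le> 6 * W"
  proof (cases "\<beta> \<le> 6 * W")
    case False
    \<comment> \<open>The bundle at price \<open>\<beta>\<close> sells with probability at least one
      half, which gives even \<open>\<beta> \<le> 2 * W\<close>.\<close>
    then have "1 / 2 \<le> measure_pmf.prob V {v. \<beta> \<le> total v}"
      using True measure_pmf.prob_neg[of V "\<lambda>v. total v < \<beta>"] by (simp add: not_less)
    then have "\<beta> * (1 / 2) \<le> \<beta> * measure_pmf.prob V {v. \<beta> \<le> total v}"
      using \<beta>_nonneg by (intro mult_left_mono)
    then show ?thesis using bundle_pricing[of \<beta>] \<beta>_nonneg W_nonneg by simp
  qed
  moreover have "E p \<le> E (\<lambda>v. \<beta>)" by (intro E_mono budget)
  ultimately show ?thesis using W_nonneg by simp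
next
  case False
  then have likely: "1 / 2 \<le> measure_pmf.prob V {v. total v < \<beta>}" and W: "6 * W < \<beta>" by auto
  \<comment> \<open>The choice breaks ties, so that at most one term of \<open>A v\<close> below is
    nonzero.\<close>
  define fav where "fav v = (SOME j. j < m \<and> (\<forall>i<m. v i \<le> v j))" for v :: "nat \<Rightarrow> real"
  have fav: "fav v < m \<and> (\<forall>i<m. v i \<le> v (fav v))" if "0 < m" for v
  proof -
    have "Max (v ` {..<m}) \<in> v ` {..<m}" using that by (intro Max_in) auto
    then obtain j where "j < m" "v j = Max (v ` {..<m})" by force
    then have "j < m \<and> (\<forall>i<m. v i \<le> v j)" by simp
    then show ?thesis unfolding fav_def by (rule someI)
  qed
  define fee where "fee j v = \<pi> v j * v j - utility m v (\<pi> v) (p v)" for j v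
  define A where "A v = (\<Sum>j<m. fee j v * of_bool (fav v = j \<and> total v < \<beta>))" for v
  define T where "T v = (\<Sum>j<m. v j * of_bool (6 * W < v j) *
      of_bool ((\<exists>i<m. i \<noteq> j \<and> v j \<le> v i) \<and> total v < \<beta>))" for v
  define C where "C v = (\<Sum>j<m. v j * of_bool (v j \<le> 6 * W))" for v
  have pointwise: "p v \<le> \<beta> * of_bool (\<beta> \<le> total v) + A v + T v + C v"
    if v: "v \<in> set_pmf V" for v
  proof -
    have T_nonneg: "0 \<le> T v" unfolding T_def using V_nonneg[OF v] by (intro sum_nonneg) auto
    have C_nonneg: "0 \<le> C v" unfolding C_def using V_nonneg[OF v] by (intro sum_nonneg) auto
    consider "\<beta> \<le> total v" | "total v < \<beta>" "m = 0" | "total v < \<beta>" "0 < m" by fastforce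
    then show ?thesis
    proof cases
      case 1
      then have "A v = 0" by (simp add: A_def)
      then show ?thesis using budget[OF v] 1 T_nonneg C_nonneg by simp
    next
      case 2
      then show ?thesis using ir[OF v] by (simp add: utility_def A_def T_def C_def)
    next
      case 3
      \<comment> \<open>By the definition of \<open>utility\<close>, \<open>p v\<close> is
        \<open>fee k v\<close> plus the terms \<open>\<pi> v j * v j\<close> of the other items, for
        which \<open>k\<close> is the witness in the tail condition.\<close>
      define k where "k = fav v"
      have k: "k < m" "\<And>i. i < m \<Longrightarrow> v i \<le> v k" using fav[OF 3(2), of v] by (auto simp: k_def)
      have "A v = (\<Sum>j<m. if k = j then fee j v else 0)"
        unfolding A_def k_def using 3 by (intro sum.cong) auto
      then have A: "A v = fee k v" using k by simp
      have "(\<Sum>j\<in>{..<m} - {k}. \<pi> v j * v j) \<le> (\<Sum>j\<in>{..<m} - {k}. v j)"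
        using alloc[OF v] V_nonneg[OF v] by (intro sum_mono) (auto intro: mult_left_le_one_le)
      also have "\<dots> \<le> (\<Sum>j\<in>{..<m} - {k}. v j * of_bool (6 * W < v j) *
          of_bool ((\<exists>i<m. i \<noteq> j \<and> v j \<le> v i) \<and> total v < \<beta>) + v j * of_bool (v j \<le> 6 * W))"
      proof (rule sum_mono)
        fix j assume "j \<in> {..<m} - {k}"
        then have "\<exists>i<m. i \<noteq> j \<and> v j \<le> v i" using k by blast
        then show "v j \<le> v j * of_bool (6 * W < v j) *
            of_bool ((\<exists>i<m. i \<noteq> j \<and> v j \<le> v i) \<and> total v < \<beta>) + v j * of_bool (v j \<le> 6 * W)"
          using 3 by (cases "6 * W < v j") auto
      qed
      also have "\<dots> \<le> (\<Sum>j<m. v j * of_bool (6 * W < v j) *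
          of_bool ((\<exists>i<m. i \<noteq> j \<and> v j \<le> v i) \<and> total v < \<beta>) + v j * of_bool (v j \<le> 6 * W))"
        using V_nonneg[OF v] by (intro sum_mono2) auto
      also have "\<dots> = T v + C v" unfolding T_def C_def by (rule sum.distrib)
      finally have "(\<Sum>j<m. \<pi> v j * v j) \<le> \<pi> v k * v k + T v + C v"
        using k by (subst sum.remove[of _ k]) auto
      then show ?thesis using 3 by (simp add: A fee_def utility_def)
    qed
  qed
  have "E p \<le> E (\<lambda>v. \<beta> * of_bool (\<beta> \<le> total v) + A v + T v + C v)"
    by (intro E_mono pointwise)
  also have "\<dots> = \<beta> * measure_pmf.prob V {v. \<beta> \<le> total v} + E A + E T + E C"
    by (simp add: E_of_bool)
  also have "\<dots> \<le> W + 6 * W + 6 * W + 48 * W"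
  proof (intro add_mono)
    show "\<beta> * measure_pmf.prob V {v. \<beta> \<le> total v} \<le> W"
      using \<beta>_nonneg by (intro bundle_pricing) auto
    show "E A \<le> 6 * W"
      unfolding A_def fee_def using likely by (intro E_favorite_payment_le) auto
    show "E T \<le> 6 * W" unfolding T_def using likely W by (intro E_tail_le) auto
    show "E C \<le> 48 * W" unfolding C_def using W by (rule E_core_le)
  qed
  finally show ?thesis by simp
qed

end

end

subsection \<open>Monotone hazard rates\<close>

context
  fixes B :: "real measure" and g :: "real \<Rightarrow> real"
  assumes budget: "budget_distribution B g"
begin

lemma g_measurable [measurable]: "g \<in> borel_measurable borel"
  and g_nonneg: "0 \<le> g b"
  and B_density: "B = density lborel (\<lambda>b. ennreal (g b))"
  and prob_space_B: "prob_space B"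
  and AE_B_nonneg: "AE b in B. 0 \<le> b"
  and integrable_B: "integrable B (\<lambda>b. b)"
  and mean_pos: "0 < (\<integral>b. b \<partial>B)"
  using budget by (auto simp: budget_distribution_def)

lemma sets_B [measurable_cong, simp]: "sets B = sets borel"
  by (subst B_density) simp

lemma space_B [simp]: "space B = UNIV"
  by (subst B_density) simp

interpretation B: prob_space B by (rule prob_space_B)

lemma emeasure_B: "A \<in> sets borel \<Longrightarrow> emeasure B A = (\<integral>\<^sup>+b. ennreal (g b) * indicator A b \<partial>lborel)"
  by (subst B_density) (simp add: emeasure_density)

lemma one_minus_cdf: "1 - cdf B x = measure B {x<..}"
  using B.prob_compl[of "{..x}"] by (simp add: cdf_def Compl_eq_Diff_UNIV[symmetric] Compl_atMost)

lemma cdf_le_one: "cdf B x \<le> 1"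
  by (simp add: cdf_def)

lemma cdf_le_mult_bound:
  assumes h: "\<And>t. 0 \<le> t \<Longrightarrow> t \<le> x \<Longrightarrow> g t \<le> h" and x: "0 \<le> x" and h0: "0 \<le> h"
  shows "cdf B x \<le> h * x"
proof -
  have "emeasure B {..x} = emeasure B {0..x}"
    using AE_B_nonneg by (intro emeasure_eq_AE) auto
  also have "\<dots> \<le> (\<integral>\<^sup>+b. ennreal h * indicator {0..x} b \<partial>lborel)"
    unfolding emeasure_B[of "{0..x}", simplified] using h
    by (intro nn_integral_mono) (auto simp: indicator_def intro!: ennreal_leI)
  also have "\<dots> = ennreal (h * x)"
    using x h0 by (simp add: nn_integral_cmult_indicator ennreal_mult)
  finally show ?thesis
    using x h0 by (simp add: cdf_def B.emeasure_eq_measure)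
qed

text \<open>Tail formula: the expected excess is the integral of \<open>1 - cdf B t\<close> over
  \<open>t > x\<close>, and \<open>h\<close> times the integrand is at most \<open>g t\<close>,
  which integrates to \<open>1 - cdf B x\<close>.\<close>

lemma mult_expected_excess_le:
  assumes h: "\<And>t. x < t \<Longrightarrow> h * (1 - cdf B t) \<le> g t" and h0: "0 \<le> h"
  shows "h * (\<integral>b. max 0 (b - x) \<partial>B) \<le> 1 - cdf B x"
proof -
  interpret pair_sigma_finite lborel B ..
  \<comment> \<open>Integrating \<open>k\<close> over \<open>t\<close> first gives the scaled
    excess; over \<open>b\<close> first, the scaled tail probabilities.\<close>
  define k :: "real \<Rightarrow> real \<Rightarrow> ennreal" where
    "k t b = ennreal h * indicator {p. x < fst p \<and> fst p < snd p} (t, b)" for t b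
  have [measurable]: "case_prod k \<in> borel_measurable (lborel \<Otimes>\<^sub>M B)"
    unfolding k_def by measurable
  have int: "integrable B (\<lambda>b. max 0 (b - x))"
    using integrable_B by (intro integrable_max) auto
  have "ennreal (h * (\<integral>b. max 0 (b - x) \<partial>B)) = (\<integral>\<^sup>+b. ennreal (h * max 0 (b - x)) \<partial>B)"
    using int h0 by (subst nn_integral_eq_integral) auto
  also have "\<dots> = (\<integral>\<^sup>+b. (\<integral>\<^sup>+t. k t b \<partial>lborel) \<partial>B)"
  proof (intro nn_integral_cong)
    fix b
    have "(\<lambda>t. k t b) = (\<lambda>t. ennreal h * indicator {x<..<b} t)"
      by (auto simp: k_def indicator_def)
    then have "(\<integral>\<^sup>+t. k t b \<partial>lborel) = ennreal h * emeasure lborel {x<..<b}"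
      by (simp add: nn_integral_cmult_indicator)
    also have "emeasure lborel {x<..<b} = ennreal (max 0 (b - x))"
      by (cases "x \<le> b") auto
    finally show "ennreal (h * max 0 (b - x)) = (\<integral>\<^sup>+t. k t b \<partial>lborel)"
      using h0 by (simp add: ennreal_mult)
  qed
  also have "\<dots> = (\<integral>\<^sup>+t. (\<integral>\<^sup>+b. k t b \<partial>B) \<partial>lborel)"
    by (rule Fubini') measurable
  also have "\<dots> \<le> (\<integral>\<^sup>+t. ennreal (g t) * indicator {x<..} t \<partial>lborel)"
  proof (intro nn_integral_mono)
    fix t
    show "(\<integral>\<^sup>+b. k t b \<partial>B) \<le> ennreal (g t) * indicator {x<..} t"
    proof (cases "x < t")
      case True
      then have "(\<lambda>b. k t b) = (\<lambda>b. ennreal h * indicator {t<..} b)"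
        by (auto simp: k_def indicator_def)
      then have "(\<integral>\<^sup>+b. k t b \<partial>B) = ennreal (h * (1 - cdf B t))"
        using h0 by (simp add: nn_integral_cmult_indicator one_minus_cdf B.emeasure_eq_measure ennreal_mult)
      then show ?thesis using h[OF True] True by (simp add: ennreal_leI)
    qed (simp add: k_def)
  qed
  also have "\<dots> = ennreal (1 - cdf B x)"
    using emeasure_B[of "{x<..}"] by (simp add: one_minus_cdf B.emeasure_eq_measure)
  finally show ?thesis using cdf_le_one[of x] by (simp add: ennreal_le_iff)
qed

text \<open>
  With \<open>h\<close> the hazard rate at \<open>x\<close>, monotonicity gives \<open>g \<le> h\<close> before \<open>x\<close> and
  \<open>h * (1 - cdf B t) \<le> g t\<close> after \<open>x\<close>, which bound \<open>cdf B x\<close> and the expected excess over \<open>x\<close>.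
\<close>

lemma cdf_mult_mean_le:
  assumes mhr: "MHR B g" and x: "0 \<le> x" "cdf B x < 1"
  shows "cdf B x * (\<integral>b. b \<partial>B) \<le> x"
proof -
  define h where "h = g x / (1 - cdf B x)"
  have h0: "0 \<le> h" using g_nonneg x by (simp add: h_def)
  have mono: "g s / (1 - cdf B s) \<le> g t / (1 - cdf B t)" if "s \<le> t" "cdf B t < 1" for s t
  proof -
    have "cdf B s \<le> cdf B t"
      using that(1) by (auto simp: cdf_def intro!: B.finite_measure_mono)
    then show ?thesis using mhr that by (auto simp: MHR_def mono_on_def)
  qed
  have "cdf B x \<le> h * x"
  proof (rule cdf_le_mult_bound)
    fix t assume t: "t \<le> x"
    have "cdf B t \<le> cdf B x"
      using t by (auto simp: cdf_def intro!: B.finite_measure_mono)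
    then have ct: "cdf B t < 1" using x by simp
    then have "g t \<le> h * (1 - cdf B t)"
      using mono[OF t x(2)] by (simp add: h_def[symmetric] field_simps)
    also have "\<dots> \<le> h" using h0 by (simp add: cdf_def mult_left_le)
    finally show "g t \<le> h" .
  qed (use x h0 in auto)
  moreover have excess: "h * (\<integral>b. max 0 (b - x) \<partial>B) \<le> 1 - cdf B x"
  proof (rule mult_expected_excess_le)
    fix t assume t: "x < t"
    show "h * (1 - cdf B t) \<le> g t"
    proof (cases "cdf B t < 1")
      case True
      then show ?thesis
        using mono[of x t] t by (simp add: h_def[symmetric] field_simps)
    next
      case False
      then have "cdf B t = 1" using cdf_le_one[of t] by simp
      then show ?thesis using g_nonneg by simp
    qed
  qed (rule h0)
  \<comment> \<open>With \<open>F\<close> for \<open>cdf B x\<close> and \<open>e\<close> for the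
    expected excess, the mean times \<open>F\<close> is at most \<open>F * x + F * e \<le> F * x + h
    * x * e \<le> F * x + x * (1 - F) = x\<close>.\<close>
  moreover have "(\<integral>b. b \<partial>B) \<le> x + (\<integral>b. max 0 (b - x) \<partial>B)"
  proof -
    have int: "integrable B (\<lambda>b. max 0 (b - x))"
      using integrable_B by (intro integrable_max) auto
    have "(\<integral>b. b \<partial>B) \<le> (\<integral>b. x + max 0 (b - x) \<partial>B)"
      using int integrable_B by (intro integral_mono) auto
    then show ?thesis using int B.prob_space by simp
  qed
  then have "cdf B x * (\<integral>b. b \<partial>B) \<le> cdf B x * x + cdf B x * (\<integral>b. max 0 (b - x) \<partial>B)"
    using mult_left_mono[of _ _ "cdf B x"] by (force simp: cdf_def algebra_simps)
  moreover have "cdf B x * (\<integral>b. max 0 (b - x) \<partial>B) \<le> h * x * (\<integral>b. max 0 (b - x) \<partial>B)"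
    using \<open>cdf B x \<le> h * x\<close> by (intro mult_right_mono) auto
  moreover have "x * (h * (\<integral>b. max 0 (b - x) \<partial>B)) \<le> x * (1 - cdf B x)"
    using excess x by (intro mult_left_mono)
  ultimately show ?thesis by (simp add: algebra_simps)
qed

text \<open>At half the mean, \<open>cdf_mult_mean_le\<close> bounds the distribution function by
  one half.\<close>

lemma prob_ge_half_mean:
  assumes mhr: "MHR B g"
  shows "1 / 2 \<le> measure B {(\<integral>b. b \<partial>B) / 2..}"
proof -
  define \<beta> where "\<beta> = (\<integral>b. b \<partial>B) / 2"
  have \<beta>: "0 < \<beta>" using mean_pos by (simp add: \<beta>_def)
  \<comment> \<open>Otherwise the budget would almost surely be at most half its own positive
    mean.\<close>
  have "cdf B \<beta> < 1"
  proof (rule ccontr)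
    assume "\<not> ?thesis"
    then have "measure B {\<beta><..} = 0"
      using cdf_le_one[of \<beta>] by (simp flip: one_minus_cdf)
    then have "AE b in B. b \<notin> {\<beta><..}"
      by (intro AE_not_in) (simp add: null_sets_def B.emeasure_eq_measure)
    then have "(\<integral>b. b \<partial>B) \<le> (\<integral>b. \<beta> \<partial>B)"
      using integrable_B by (intro integral_mono_AE) auto
    then show False using \<beta> B.prob_space by (simp add: \<beta>_def)
  qed
  then have "cdf B \<beta> * (2 * \<beta>) \<le> \<beta>"
    using cdf_mult_mean_le[OF mhr, of \<beta>] \<beta> by (simp add: \<beta>_def)
  then have "cdf B \<beta> \<le> 1 / 2" using \<beta> by (simp add: field_simps)
  then have "1 / 2 \<le> measure B {\<beta><..}" by (simp flip: one_minus_cdf)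
  also have "\<dots> \<le> measure B {\<beta>..}" by (intro B.finite_measure_mono) auto
  finally show ?thesis by (simp add: \<beta>_def)
qed

end

subsection \<open>Private budgets\<close>

lemma demand_affordable:
  assumes "S \<in> demand m q v b"
  shows "S \<subseteq> {..<m}" "(\<Sum>j\<in>S. q j) \<le> b"
  using assms by (auto simp: demand_def is_arg_max_def)

lemma finite_demand: "finite (demand m q v b)"
  by (rule finite_subset[of _ "Pow {..<m}"]) (auto dest: demand_affordable)

lemma demand_nonempty:
  assumes "0 \<le> b"
  shows "demand m q v b \<noteq> {}"
proof -
  let ?X = "{S. S \<subseteq> {..<m} \<and> (\<Sum>j\<in>S. q j) \<le> b}" and ?u = "\<lambda>S. \<Sum>j\<in>S. v j - q j"
  have fin: "finite ?X" by (rule finite_subset[of _ "Pow {..<m}"]) auto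
  have "{} \<in> ?X" using assms by simp
  then have "Max (?u ` ?X) \<in> ?u ` ?X" using fin by (intro Max_in) auto
  then obtain S where S: "S \<in> ?X" "?u S = Max (?u ` ?X)" by force
  have "?u S' \<le> ?u S" if "S' \<in> ?X" for S'
    using that fin unfolding S(2) by (intro Max_ge) auto
  then have "S \<in> demand m q v b"
    using S(1) by (auto simp: demand_def is_arg_max_linorder)
  then show ?thesis by blast
qed

definition item_payment :: "nat \<Rightarrow> (nat \<Rightarrow> real) \<Rightarrow> (nat \<Rightarrow> real) \<Rightarrow> real \<Rightarrow> real" where
  "item_payment m q v b = Max ((\<lambda>S. \<Sum>j\<in>S. q j) ` demand m q v b)"

lemma item_payment_bounds:
  assumes q: "\<And>j. j < m \<Longrightarrow> 0 \<le> q j" and b: "0 \<le> b"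
  shows "0 \<le> item_payment m q v b" "item_payment m q v b \<le> b"
proof -
  have "item_payment m q v b \<in> (\<lambda>S. \<Sum>j\<in>S. q j) ` demand m q v b"
    unfolding item_payment_def using finite_demand demand_nonempty[OF b] by (intro Max_in) auto
  then obtain S where S: "S \<in> demand m q v b" "item_payment m q v b = (\<Sum>j\<in>S. q j)" by blast
  then show "0 \<le> item_payment m q v b" "item_payment m q v b \<le> b"
    using q demand_affordable[OF S(1)] by (auto intro!: sum_nonneg)
qed

text \<open>The items priced at or below their values are affordable within \<open>b\<close>, and
  this set is optimal even without a budget, so it is demanded; breaking ties for the seller can
  only raise the payment.\<close>

lemma item_payment_ge:
  assumes q: "\<And>j. j < m \<Longrightarrow> 0 \<le> q j" and v: "\<And>j. j < m \<Longrightarrow> 0 \<le> v j"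
    and b: "(\<Sum>j<m. v j) \<le> b"
  shows "(\<Sum>j<m. q j * of_bool (q j \<le> v j)) \<le> item_payment m q v b"
proof -
  let ?S = "{j \<in> {..<m}. q j \<le> v j}"
  have sum: "(\<Sum>j\<in>?S. q j) = (\<Sum>j<m. q j * of_bool (q j \<le> v j))"
    by (intro sum.mono_neutral_cong_left) auto
  have "(\<Sum>j\<in>?S. q j) \<le> (\<Sum>j<m. v j)"
    unfolding sum using v by (intro sum_mono) auto
  then have "(\<Sum>j\<in>?S. q j) \<le> b" using b by simp
  moreover have "(\<Sum>j\<in>S. v j - q j) \<le> (\<Sum>j\<in>?S. v j - q j)" if S: "S \<subseteq> {..<m}" for S
  proof -
    have "(\<Sum>j\<in>S. v j - q j) \<le> (\<Sum>j\<in>S \<inter> ?S. v j - q j)"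
    proof -
      have "(\<Sum>j\<in>S. v j - q j) = (\<Sum>j\<in>S \<inter> ?S. v j - q j) + (\<Sum>j\<in>S - ?S. v j - q j)"
        using S by (intro sum.Int_Diff) (rule finite_subset, auto)
      moreover have "(\<Sum>j\<in>S - ?S. v j - q j) \<le> 0" using S by (intro sum_nonpos) auto
      ultimately show ?thesis by linarith
    qed
    also have "\<dots> \<le> (\<Sum>j\<in>?S. v j - q j)"
      by (intro sum_mono2) auto
    finally show ?thesis .
  qed
  ultimately have "?S \<in> demand m q v b"
    by (auto simp: demand_def is_arg_max_linorder)
  then show ?thesis
    unfolding item_payment_def sum[symmetric] using finite_demand by (intro Max_ge) auto
qed

text \<open>The demand depends on the budget only through the finite family of affordable sets.\<close>

lemma item_payment_measurable:
  assumes [measurable_cong]: "sets B = sets borel"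
  shows "(\<lambda>(v, b). item_payment m q v b) \<in> borel_measurable (joint V B)"
proof -
  define pay where "pay v \<A> = Max ((\<lambda>S. \<Sum>j\<in>S. q j) ` {S. is_arg_max (\<lambda>S. \<Sum>j\<in>S. v j - q j) (\<lambda>S. S \<in> \<A>) S})"
    for v and \<A> :: "nat set set"
  define aff where "aff b = {S. S \<subseteq> {..<m} \<and> (\<Sum>j\<in>S. q j) \<le> b}" for b
  \<comment> \<open>Only the term with \<open>\<A> = aff b\<close> survives. Each term is a function
    of \<open>v\<close>, measurable on a discrete space, times a measurable condition on
    \<open>b\<close>.\<close>
  have eq: "item_payment m q v b
      = (\<Sum>\<A>\<in>Pow (Pow {..<m}). pay v \<A> * of_bool (\<forall>S\<in>Pow {..<m}. (\<Sum>j\<in>S. q j) \<le> b \<longleftrightarrow> S \<in> \<A>))"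
    for v b
  proof -
    have "(\<Sum>\<A>\<in>Pow (Pow {..<m}). pay v \<A> * of_bool (\<forall>S\<in>Pow {..<m}. (\<Sum>j\<in>S. q j) \<le> b \<longleftrightarrow> S \<in> \<A>))
        = (\<Sum>\<A>\<in>Pow (Pow {..<m}). if \<A> = aff b then pay v \<A> else 0)"
      by (intro sum.cong refl) (auto simp: aff_def)
    also have "\<dots> = pay v (aff b)"
      by (auto simp: aff_def)
    finally show ?thesis by (simp add: pay_def aff_def item_payment_def demand_def)
  qed
  have [measurable]: "(\<lambda>z. pay (fst z) \<A>) \<in> borel_measurable (measure_pmf V \<Otimes>\<^sub>M B)" for \<A>
    by (rule measurable_compose[OF measurable_fst]) simp
  have [measurable]: "Measurable.pred (measure_pmf V \<Otimes>\<^sub>M B)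
      (\<lambda>z. \<forall>S\<in>Pow {..<m}. (\<Sum>j\<in>S. q j) \<le> snd z \<longleftrightarrow> S \<in> \<A>)" for \<A>
    by (rule pred_intros_finite) auto
  show ?thesis
    unfolding eq joint_def case_prod_beta by measurable
qed

section \<open>Comparison of the private budget with public ones\<close>

locale private_budget = item_values +
  fixes B :: "real measure" and g :: "real \<Rightarrow> real"
  assumes budget: "budget_distribution B g" and mhr: "MHR B g"
begin

sublocale B: prob_space B by (rule prob_space_B[OF budget])

sublocale joint: pair_prob_space "measure_pmf V" B ..

lemmas sets_B' [measurable_cong, simp] = sets_B[OF budget]

lemmas space_B' [simp] = space_B[OF budget]

lemma integrable_indicator_B [simp]: "integrable B (indicat_real {c..})"
  by (intro integrable_real_indicator) (auto simp: B.emeasure_eq_measure)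

abbreviation mean :: real where "mean \<equiv> \<integral>b. b \<partial>B"

text \<open>The budget dominates \<open>F\<close>, so its finite mean gives integrability and
  Fubini's theorem applies.\<close>

lemma
  fixes F :: "(nat \<Rightarrow> real) \<Rightarrow> real \<Rightarrow> real"
  assumes meas: "(\<lambda>(v, b). F v b) \<in> borel_measurable (joint V B)"
    and bounds: "\<And>v b. 0 \<le> b \<Longrightarrow> 0 \<le> F v b \<and> F v b \<le> b"
  shows integrable_slice: "integrable B (F v)"
    and integral_joint_eq: "(\<integral>(v, b). F v b \<partial>joint V B) = E (\<lambda>v. \<integral>b. F v b \<partial>B)"
    and integral_joint_le_mean: "(\<integral>(v, b). F v b \<partial>joint V B) \<le> mean"
proof -
  have meas' [measurable]: "(\<lambda>(v, b). F v b) \<in> borel_measurable (measure_pmf V \<Otimes>\<^sub>M B)"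
    using meas by (simp add: joint_def)
  have slice [measurable]: "F v \<in> borel_measurable B" for v
    using measurable_Pair2[OF meas', of v] by simp
  have AE: "AE b in B. 0 \<le> F v b \<and> F v b \<le> b" for v
    using AE_B_nonneg[OF budget] by eventually_elim (use bounds in auto)
  show int: "integrable B (F v)" for v
    by (rule Bochner_Integration.integrable_bound[OF integrable_B[OF budget] slice])
      (use AE[of v] in eventually_elim, auto)
  have joint_int: "integrable (measure_pmf V \<Otimes>\<^sub>M B) (\<lambda>(v, b). F v b)"
  proof (rule joint.Fubini_integrable)
    show "integrable (measure_pmf V) (\<lambda>v. \<integral>b. norm (case (v, b) of (v, b) \<Rightarrow> F v b) \<partial>B)"
      by simp
  qed (use int in auto)
  show eq: "(\<integral>(v, b). F v b \<partial>joint V B) = E (\<lambda>v. \<integral>b. F v b \<partial>B)"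
    unfolding joint_def by (rule joint.integral_fst[OF joint_int, symmetric])
  have "E (\<lambda>v. \<integral>b. F v b \<partial>B) \<le> E (\<lambda>v. mean)"
    using AE int integrable_B[OF budget] by (intro E_mono integral_mono_AE) auto
  then show "(\<integral>(v, b). F v b \<partial>joint V B) \<le> mean" by (simp add: eq)
qed

text \<open>For \<open>b \<ge> \<beta>\<close> and total value below \<open>\<beta>\<close>,
  \<open>item_payment_ge\<close> applies; elsewhere payments are nonnegative. Independence of values
  and budget gives the product.\<close>

lemma SRev_ge:
  assumes q: "\<And>j. j < m \<Longrightarrow> 0 \<le> q j"
  shows "E (\<lambda>v. (\<Sum>j<m. q j * of_bool (q j \<le> v j)) * of_bool (total v < \<beta>)) * measure B {\<beta>..}
    \<le> SRev m V B"
proof -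
  let ?Y = "\<lambda>v. (\<Sum>j<m. q j * of_bool (q j \<le> v j)) * of_bool (total v < \<beta>)"
  note meas = item_payment_measurable[OF sets_B[OF budget]]
  have "E ?Y * measure B {\<beta>..} = E (\<lambda>v. \<integral>b. ?Y v * indicator {\<beta>..} b \<partial>B)"
    by simp
  also have "\<dots> \<le> E (\<lambda>v. \<integral>b. item_payment m q v b \<partial>B)"
  proof (intro E_mono integral_mono_AE)
    fix v assume v: "v \<in> set_pmf V"
    show "integrable B (item_payment m q v)"
      by (rule integrable_slice[OF meas]) (use q item_payment_bounds in auto)
    show "AE b in B. ?Y v * indicator {\<beta>..} b \<le> item_payment m q v b"
      using AE_B_nonneg[OF budget]
    proof eventually_elim
      fix b :: real assume b: "0 \<le> b"
      show "?Y v * indicator {\<beta>..} b \<le> item_payment m q v b"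
      proof (cases "total v < \<beta> \<and> \<beta> \<le> b")
        case True
        then show ?thesis using item_payment_ge[of m q v b] q V_nonneg[OF v] by simp
      next
        case False
        then have "?Y v * indicator {\<beta>..} b = 0" by auto
        also have "0 \<le> item_payment m q v b" using q b by (rule item_payment_bounds)
        finally show ?thesis .
      qed
    qed
  qed simp
  also have "\<dots> = (\<integral>(v, b). item_payment m q v b \<partial>joint V B)"
    by (rule integral_joint_eq[OF meas, symmetric]) (use q item_payment_bounds in auto)
  also have "\<dots> \<le> SRev m V B"
    unfolding SRev_def item_payment_def
  proof (rule cSUP_upper)
    show "bdd_above ((\<lambda>q. \<integral>(v, b). Max ((\<lambda>S. \<Sum>j\<in>S. q j) ` demand m q v b) \<partial>joint V B) `
        {q. \<forall>j<m. 0 \<le> q j})"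
      using integral_joint_le_mean[OF meas] item_payment_bounds
      by (intro bdd_aboveI[of _ mean]) (auto simp: item_payment_def)
  qed (use q in auto)
  finally show ?thesis .
qed

lemma bundle_prob:
  "\<P>((v, b) in joint V B. (\<Sum>j<m. \<bar>v j\<bar>) \<ge> c \<and> b \<ge> c)
    = measure_pmf.prob V {v. c \<le> total v} * measure B {c..}"
proof -
  have *: "{(v, b). (v, b) \<in> space (joint V B) \<and> (\<Sum>j<m. \<bar>v j\<bar>) \<ge> c \<and> b \<ge> c}
      = {v. c \<le> (\<Sum>j<m. \<bar>v j\<bar>)} \<times> {c..}"
    by (auto simp: joint_def space_pair_measure)
  have "measure_pmf.prob V {v. c \<le> (\<Sum>j<m. \<bar>v j\<bar>)} = measure_pmf.prob V {v. c \<le> total v}"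
    using V_nonneg by (intro measure_eq_AE) (auto simp: AE_measure_pmf_iff)
  moreover have "measure (joint V B) ({v. c \<le> (\<Sum>j<m. \<bar>v j\<bar>)} \<times> {c..})
      = measure_pmf.prob V {v. c \<le> (\<Sum>j<m. \<bar>v j\<bar>)} * measure B {c..}"
    by (simp add: joint_def measure_def B.emeasure_pair_measure_Times enn2real_mult)
  ultimately show ?thesis unfolding * by simp
qed

lemma BRev_ge:
  assumes c: "0 \<le> c"
  shows "c * (measure_pmf.prob V {v. c \<le> total v} * measure B {c..}) \<le> BRev m V B"
proof -
  \<comment> \<open>Markov's inequality bounds these revenues, so the real supremum dominates each
    of them.\<close>
  have "c * (measure_pmf.prob V {v. c \<le> total v} * measure B {c..}) \<le> mean" if c: "0 \<le> c" for c
  proof -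
    have "measure_pmf.prob V {v. c \<le> total v} * measure B {c..} \<le> measure B {c..}"
      by (simp add: mult_left_le_one_le)
    then have "c * (measure_pmf.prob V {v. c \<le> total v} * measure B {c..}) \<le> c * measure B {c..}"
      using c by (rule mult_left_mono)
    also have "\<dots> = (\<integral>b. c * indicator {c..} b \<partial>B)" by simp
    also have "\<dots> \<le> mean"
    proof (rule integral_mono_AE)
      show "AE b in B. c * indicator {c..} b \<le> b"
        using AE_B_nonneg[OF budget] by eventually_elim (auto split: split_indicator)
    qed (use integrable_B[OF budget] in auto)
    finally show ?thesis .
  qed
  then have "bdd_above ((\<lambda>c. c * \<P>((v, b) in joint V B. (\<Sum>j<m. \<bar>v j\<bar>) \<ge> c \<and> b \<ge> c)) ` {0..})"
    by (intro bdd_aboveI[of _ mean]) (auto simp: bundle_prob)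
  then show ?thesis
    unfolding BRev_def bundle_prob[symmetric] using c by (intro cSUP_upper) auto
qed

text \<open>The factor 2 pays for counting only budgets of at least half the mean, which have
  probability at least one half.\<close>

lemma public_budget_half_mean: "public_budget m D (mean / 2) (2 * max (SRev m V B) (BRev m V B))"
proof unfold_locales
  note half = prob_ge_half_mean[OF budget mhr]
  show "0 \<le> mean / 2" using mean_pos[OF budget] by simp
  show "0 \<le> 2 * max (SRev m V B) (BRev m V B)" using BRev_ge[of 0] by simp
  fix q :: "nat \<Rightarrow> real" assume q: "\<And>j. j < m \<Longrightarrow> 0 \<le> q j"
  let ?Y = "\<lambda>v. (\<Sum>j<m. q j * of_bool (q j \<le> v j)) * of_bool (total v < mean / 2)"
  have "0 \<le> E ?Y" using q by (intro Bochner_Integration.integral_nonneg) (auto intro!: sum_nonneg)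
  then have "E ?Y * (1 / 2) \<le> E ?Y * measure B {mean / 2..}"
    using half by (intro mult_left_mono)
  also have "\<dots> \<le> SRev m V B" by (rule SRev_ge[OF q])
  finally show "E ?Y \<le> 2 * max (SRev m V B) (BRev m V B)" by linarith
next
  note half = prob_ge_half_mean[OF budget mhr]
  fix c :: real assume c: "0 \<le> c" "c \<le> mean / 2"
  have "1 / 2 \<le> measure B {c..}"
    using half c by (intro order.trans[OF half] B.finite_measure_mono) auto
  then have "c * measure_pmf.prob V {v. c \<le> total v} * (1 / 2)
      \<le> c * measure_pmf.prob V {v. c \<le> total v} * measure B {c..}"
    using c by (intro mult_left_mono) auto
  also have "\<dots> \<le> BRev m V B" using BRev_ge[OF c(1)] by (simp add: mult.assoc)
  finally show "c * measure_pmf.prob V {v. c \<le> total v} \<le> 2 * max (SRev m V B) (BRev m V B)"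
    by linarith
qed

text \<open>
  Scaling allocation and payments by \<open>\<beta> / (\<beta> + b)\<close> turns the mechanism at budget \<open>b\<close> into one whose
  payments are at most the public budget \<open>\<beta>\<close>.
\<close>

lemma expected_payment_at_budget_le:
  assumes mech: "mechanism m V B \<pi> p" and b: "b \<in> supp B" "0 \<le> b"
  shows "E (\<lambda>t. p t b) \<le> 122 * max (SRev m V B) (BRev m V B) * (1 + 2 * b / mean)"
proof -
  define \<beta> where "\<beta> = mean / 2"
  \<comment> \<open>This choice makes \<open>1 / s = 1 + b / \<beta>\<close> affine in
    \<open>b\<close>, so only the mean budget enters when integrating over \<open>b\<close>.\<close>
  define s where "s = \<beta> / (\<beta> + b)"
  interpret public_budget m D \<beta> "2 * max (SRev m V B) (BRev m V B)"
    unfolding \<beta>_def by (rule public_budget_half_mean)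
  have \<beta>: "0 < \<beta>" using mean_pos[OF budget] by (simp add: \<beta>_def)
  have s: "0 < s" "s \<le> 1" "s * b \<le> \<beta>"
    using \<beta> b by (auto simp: s_def field_simps)
  have scale: "utility m t (\<lambda>j. s * x j) (s * c) = s * utility m t x c" for t x c
    by (simp add: utility_def sum_distrib_left algebra_simps)
  \<comment> \<open>Deviations to \<open>t'\<close> keep the report \<open>b\<close>, so
    \<open>p t' b \<le> b\<close> makes them affordable and the premise of incentive compatibility
    disappears.\<close>
  have mech: "\<And>j. j < m \<Longrightarrow> \<pi> t b j \<in> {0..1}" "p t b \<le> b" "0 \<le> utility m t (\<pi> t b) (p t b)"
    "\<And>t'. t' \<in> set_pmf V \<Longrightarrow> utility m t (\<pi> t' b) (p t' b) \<le> utility m t (\<pi> t b) (p t b)"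
    if "t \<in> set_pmf V" for t
    using mech b that by (auto simp: mechanism_def)
  have "E (\<lambda>t. s * p t b) \<le> 61 * (2 * max (SRev m V B) (BRev m V B))"
  proof (rule E_payment_le[where \<pi> = "\<lambda>t j. s * \<pi> t b j"])
    fix t assume t: "t \<in> set_pmf V"
    show "s * \<pi> t b j \<in> {0..1}" if "j < m" for j
      using mech(1)[OF t that] s by (auto intro: mult_le_one)
    have "s * p t b \<le> s * b" using mech(2)[OF t] s by (intro mult_left_mono) auto
    then show "s * p t b \<le> \<beta>" using s by linarith
    show "0 \<le> utility m t (\<lambda>j. s * \<pi> t b j) (s * p t b)"
      unfolding scale using mech(3)[OF t] s by simp
    show "utility m t (\<lambda>j. s * \<pi> t' b j) (s * p t' b) \<le> utility m t (\<lambda>j. s * \<pi> t b j) (s * p t b)"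
      if "t' \<in> set_pmf V" for t'
      unfolding scale using mech(4)[OF t that] s by simp
  qed
  then have "s * E (\<lambda>t. p t b) \<le> 122 * max (SRev m V B) (BRev m V B)" by simp
  then have "E (\<lambda>t. p t b) \<le> 122 * max (SRev m V B) (BRev m V B) * (1 / s)"
    using s(1) by (simp add: field_simps)
  also have "1 / s = 1 + 2 * b / mean"
    using \<beta> b by (simp add: s_def \<beta>_def field_simps)
  finally show ?thesis .
qed

text \<open>The bound at each budget is averaged: \<open>1 + 2 * b / mean\<close> has expectation 3,
  and \<open>122 * 3 = 366\<close>.\<close>

lemma revenue_le:
  assumes mech: "mechanism m V B \<pi> p"
  shows "set_lebesgue_integral (joint V B) (set_pmf V \<times> supp B) (\<lambda>(t, b). p t b)
    \<le> 366 * max (SRev m V B) (BRev m V B)"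
proof -
  define M where "M = max (SRev m V B) (BRev m V B)"
  define F where "F t b = indicator (set_pmf V \<times> supp B) (t, b) * p t b" for t b
  have M: "0 \<le> M" using BRev_ge[of 0] by (simp add: M_def)
  have F: "(\<lambda>z. indicator (set_pmf V \<times> supp B) z *\<^sub>R (case z of (t, b) \<Rightarrow> p t b)) = (\<lambda>(t, b). F t b)"
    by (auto simp: F_def)
  have int: "integrable (measure_pmf V \<Otimes>\<^sub>M B) (\<lambda>(t, b). F t b)"
    using mech unfolding mechanism_def set_integrable_def F joint_def by blast
  have "set_lebesgue_integral (joint V B) (set_pmf V \<times> supp B) (\<lambda>(t, b). p t b)
      = (\<integral>b. E (\<lambda>t. F t b) \<partial>B)"
    unfolding set_lebesgue_integral_def F joint_def by (rule joint.integral_snd[OF int, symmetric])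
  also have "\<dots> \<le> (\<integral>b. 122 * M * (1 + 2 * b / mean) \<partial>B)"
  proof (rule integral_mono_AE)
    show "integrable B (\<lambda>b. E (\<lambda>t. F t b))" by (rule joint.integrable_snd[OF int])
    show "integrable B (\<lambda>b. 122 * M * (1 + 2 * b / mean))"
      using integrable_B[OF budget] by simp
    show "AE b in B. E (\<lambda>t. F t b) \<le> 122 * M * (1 + 2 * b / mean)"
      using AE_B_nonneg[OF budget]
    proof eventually_elim
      fix b :: real assume b: "0 \<le> b"
      show "E (\<lambda>t. F t b) \<le> 122 * M * (1 + 2 * b / mean)"
      proof (cases "b \<in> supp B")
        case True
        then have "E (\<lambda>t. F t b) = E (\<lambda>t. p t b)"
          by (intro E_cong) (simp add: F_def)
        then show ?thesis using expected_payment_at_budget_le[OF mech True b] by (simp add: M_def)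
      next
        case False
        then show ?thesis using M b mean_pos[OF budget] by (simp add: F_def)
      qed
    qed
  qed
  also have "\<dots> = 122 * M * (1 + 2 * mean / mean)"
    using integrable_B[OF budget] B.prob_space by simp
  also have "\<dots> = 366 * M" using mean_pos[OF budget] by simp
  finally show ?thesis by (simp add: M_def)
qed

lemma Rev_le: "Rev m V B \<le> 366 * max (SRev m V B) (BRev m V B)"
  unfolding Rev_def
proof (rule cSUP_least)
  \<comment> \<open>Bounding the supremum requires some mechanism to exist; allocating and charging
    nothing is one once budgets in the support are nonnegative.\<close>
  have "mechanism m V B (\<lambda>_ _ _. 0) (\<lambda>_ _. 0)" if "\<forall>b\<in>supp B. 0 \<le> b"
    using that by (simp add: mechanism_def utility_def set_integrable_def case_prod_beta)
  moreover have "0 \<le> b" if b: "b \<in> supp B" for b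
  proof (rule ccontr)
    assume "\<not> 0 \<le> b"
    \<comment> \<open>The negative half-line is an open null set, so it misses the support.\<close>
    then have "emeasure B {..<0} > 0" using b by (auto simp: supp_def)
    moreover have "emeasure B {..<0} = 0"
      using AE_B_nonneg[OF budget] AE_iff_measurable[of "{..<0}" B "\<lambda>b. 0 \<le> b"]
      by (auto simp: not_le)
    ultimately show False by simp
  qed
  ultimately show "{(\<pi>, p). mechanism m V B \<pi> p} \<noteq> {}" by blast
qed (use revenue_le in auto)

end

theorem theorem3:
  "\<exists>\<alpha>::real. \<alpha> > 0 \<and>
     (\<forall>(m::nat) (D :: nat \<Rightarrow> real pmf) (B :: real measure) (g :: real \<Rightarrow> real).
        (\<forall>j<m. finite (set_pmf (D j)) \<and> set_pmf (D j) \<subseteq> {0..}) \<longrightarrow>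
        budget_distribution B g \<longrightarrow> MHR B g \<longrightarrow>
        (let V = Pi_pmf {..<m} 0 D in
           max (SRev m V B) (BRev m V B) \<ge> \<alpha> * Rev m V B))"
proof (intro exI[of _ "1 / 366"] conjI allI impI)
  fix m :: nat and D :: "nat \<Rightarrow> real pmf" and B :: "real measure" and g :: "real \<Rightarrow> real"
  assume D: "\<forall>j<m. finite (set_pmf (D j)) \<and> set_pmf (D j) \<subseteq> {0::real..}"
    and B: "budget_distribution B g" "MHR B g"
  interpret private_budget m D B g
    using D B by unfold_locales auto
  show "let V = Pi_pmf {..<m} 0 D in max (SRev m V B) (BRev m V B) \<ge> 1 / 366 * Rev m V B"
    using Rev_le by (simp add: Let_def)
qed simp

end
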